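(* ${\sf WF}\equiv_{\rm sW}{\sf WF}_L$. Also, the four problems $\widehat{\sf WF}$, $\widehat{\sf WF}_L$, ${\sf PK}$ and ${\sf PK}_L$ are pairwise strongly Weihrauch equivalent.
   Context: A tree is a set of finite sequences of natural numbers closed under initial subsequences; it is well-founded if it has no infinite path; $\mathrm{leaf}(T)$ is the set of its elements with no proper extension in it. A subtree $S$ of $T$ is perfect if every element of $S$ has two incompatible extensions in $S$; the perfect kernel of $T$ is the union of all perfect subtrees of $T$. Weihrauch problems: ${\sf WF}$ takes a tree and outputs $1$ if it is well-founded and $0$ otherwise. $\widehat{\sf WF}$ (its infinite parallelization) takes a sequence of trees $\langle T_i\rangle_{i\in\mathbb N}$ and outputs the set $\{n: T_n\text{ is well-founded}\}$. ${\sf PK}$ takes a tree and outputs its perfect kernel. The subscript $L$ denotes the same problem with each input tree $T$ given together with $\mathrm{leaf}(T)$. $f\le_{\rm sW}g$ means there are computable functionals $\Phi,\Psi$ such that for every input $x$ of $f$, $\Phi(x)$ is an input of $g$ and for every solution $y$ of $g$ on $\Phi(x)$, $\Psi(y)$ is a solution of $f$ on $x$; $\equiv_{\rm sW}$ means reducibility both ways. *)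

theory Defs
  imports Complex_Main "HOL-Library.Nat_Bijection" "HOL-Library.Sublist"
begin

section \<open>Computable functionals on Baire space\<close>

type_synonym baire = "nat \<Rightarrow> nat"

definition minimize :: "(nat \<Rightarrow> nat option) \<Rightarrow> nat option" where
  "minimize h =
     (if \<exists>k. h k = Some 0 \<and> (\<forall>j<k. h j \<noteq> None)
      then Some (LEAST k. h k = Some 0) else None)"

text \<open>
  \<open>partial_recursive n F\<close>: the values \<open>F p xs\<close> with \<open>length xs = n\<close> form an \<open>n\<close>-ary partial
  recursive function relative to the oracle \<open>p\<close>, uniformly in \<open>p\<close> (Kleene's schemes; \<open>None\<close> means
  undefined). Values at lists of another length carry no meaning.
\<close>

inductive partial_recursive :: "nat \<Rightarrow> (baire \<Rightarrow> nat list \<Rightarrow> nat option) \<Rightarrow> bool" where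
  zero: "partial_recursive n (\<lambda>p xs. Some 0)"
| successor: "partial_recursive 1 (\<lambda>p xs. Some (Suc (xs ! 0)))"
| projection: "i < n \<Longrightarrow> partial_recursive n (\<lambda>p xs. Some (xs ! i))"
| oracle_query: "partial_recursive 1 (\<lambda>p xs. Some (p (xs ! 0)))"
| composition:
    "partial_recursive (length Gs) F \<Longrightarrow> \<forall>G\<in>set Gs. partial_recursive n G \<Longrightarrow>
     partial_recursive n (\<lambda>p xs. Option.bind (those (map (\<lambda>G. G p xs) Gs)) (F p))"
| primitive_recursion:
    "partial_recursive n F \<Longrightarrow> partial_recursive (Suc (Suc n)) G \<Longrightarrow>
     partial_recursive (Suc n) (\<lambda>p xs.
       rec_nat (F p (tl xs)) (\<lambda>k r. Option.bind r (\<lambda>v. G p (k # v # tl xs))) (hd xs))"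
| minimization:
    "partial_recursive (Suc n) F \<Longrightarrow>
     partial_recursive n (\<lambda>p xs. minimize (\<lambda>k. F p (k # xs)))"

definition computable_functional :: "(baire \<Rightarrow> baire option) \<Rightarrow> bool" where
  "computable_functional \<Phi> \<longleftrightarrow>
     (\<exists>F. partial_recursive 1 F \<and>
          (\<forall>p q. \<Phi> p = Some q \<longrightarrow> (\<forall>n. F p [n] = Some (q n))))"


section \<open>Problems and strong Weihrauch reducibility\<close>

record problem =
  instances :: "baire set"
  solutions :: "baire \<Rightarrow> baire set"

definition sW_le :: "problem \<Rightarrow> problem \<Rightarrow> bool" (infix \<open>\<le>\<^sub>s\<^sub>W\<close> 50) where
  "f \<le>\<^sub>s\<^sub>W g \<longleftrightarrow>
     (\<exists>\<Phi> \<Psi>. computable_functional \<Phi> \<and> computable_functional \<Psi> \<and>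
        (\<forall>x\<in>instances f. \<exists>x'. \<Phi> x = Some x' \<and> x' \<in> instances g \<and>
           (\<forall>y\<in>solutions g x'. \<exists>z. \<Psi> y = Some z \<and> z \<in> solutions f x)))"

definition sW_equiv :: "problem \<Rightarrow> problem \<Rightarrow> bool" (infix \<open>\<equiv>\<^sub>s\<^sub>W\<close> 50) where
  "f \<equiv>\<^sub>s\<^sub>W g \<longleftrightarrow> f \<le>\<^sub>s\<^sub>W g \<and> g \<le>\<^sub>s\<^sub>W f"

text \<open>
  Inputs and outputs that are not elements of Baire space are given by names: \<open>\<delta> p x\<close> reads
  ``\<open>p\<close> is a name of \<open>x\<close>''. The problem induced by a function \<open>F\<close> has as instances the names of
  points on the input side, and as solutions all names of the value.
\<close>

type_synonym 'a representation = "baire \<Rightarrow> 'a \<Rightarrow> bool"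

definition problem_of ::
    "'a representation \<Rightarrow> 'b representation \<Rightarrow> ('a \<Rightarrow> 'b) \<Rightarrow> problem" where
  "problem_of \<delta>\<^sub>X \<delta>\<^sub>Y F =
     \<lparr> instances = {p. \<exists>x. \<delta>\<^sub>X p x},
       solutions = (\<lambda>p. {q. \<exists>x. \<delta>\<^sub>X p x \<and> \<delta>\<^sub>Y q (F x)}) \<rparr>"

definition nat_name :: "nat representation" where
  "nat_name p k \<longleftrightarrow> p 0 = k"

definition nat_set_name :: "nat set representation" where
  "nat_set_name p A \<longleftrightarrow> (\<forall>n. p n = (if n \<in> A then 1 else 0))"

definition seq_set_name :: "nat list set representation" where
  "seq_set_name p A \<longleftrightarrow> (\<forall>\<sigma>. p (list_encode \<sigma>) = (if \<sigma> \<in> A then 1 else 0))"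

definition family_name :: "'a representation \<Rightarrow> (nat \<Rightarrow> 'a) representation" where
  "family_name \<delta> p X \<longleftrightarrow> (\<forall>i. \<delta> (\<lambda>n. p (prod_encode (i, n))) (X i))"


section \<open>Trees\<close>

definition is_tree :: "nat list set \<Rightarrow> bool" where
  "is_tree T \<longleftrightarrow> (\<forall>\<tau>\<in>T. \<forall>\<sigma>. prefix \<sigma> \<tau> \<longrightarrow> \<sigma> \<in> T)"

definition well_founded_tree :: "nat list set \<Rightarrow> bool" where
  "well_founded_tree T \<longleftrightarrow> \<not> (\<exists>f :: nat \<Rightarrow> nat. \<forall>n. map f [0..<n] \<in> T)"

definition leaf :: "nat list set \<Rightarrow> nat list set" where
  "leaf T = {\<sigma> \<in> T. \<not> (\<exists>\<tau>\<in>T. strict_prefix \<sigma> \<tau>)}"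

definition perfect_subtree :: "nat list set \<Rightarrow> nat list set \<Rightarrow> bool" where
  "perfect_subtree S T \<longleftrightarrow> is_tree S \<and> S \<subseteq> T \<and>
     (\<forall>\<sigma>\<in>S. \<exists>\<tau>\<in>S. \<exists>\<rho>\<in>S. prefix \<sigma> \<tau> \<and> prefix \<sigma> \<rho> \<and> \<tau> \<parallel> \<rho>)"

definition perfect_kernel :: "nat list set \<Rightarrow> nat list set" where
  "perfect_kernel T = \<Union> {S. perfect_subtree S T}"

definition tree_name :: "nat list set representation" where
  "tree_name p T \<longleftrightarrow> is_tree T \<and> seq_set_name p T"

text \<open>A tree given together with its set of leaves, the two names being interleaved.\<close>

definition tree_leaf_name :: "nat list set representation" where
  "tree_leaf_name p T \<longleftrightarrow>
     tree_name (\<lambda>n. p (2 * n)) T \<and> seq_set_name (\<lambda>n. p (2 * n + 1)) (leaf T)"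


section \<open>The problems\<close>

definition wf_value :: "nat list set \<Rightarrow> nat" where
  "wf_value T = (if well_founded_tree T then 1 else 0)"

definition wf_indices :: "(nat \<Rightarrow> nat list set) \<Rightarrow> nat set" where
  "wf_indices T = {n. well_founded_tree (T n)}"

definition WF :: problem where
  "WF = problem_of tree_name nat_name wf_value"

definition WF_L :: problem where
  "WF_L = problem_of tree_leaf_name nat_name wf_value"

definition WF_hat :: problem where
  "WF_hat = problem_of (family_name tree_name) nat_set_name wf_indices"

definition WF_hat_L :: problem where
  "WF_hat_L = problem_of (family_name tree_leaf_name) nat_set_name wf_indices"

definition PK :: problem where
  "PK = problem_of tree_name seq_set_name perfect_kernel"

definition PK_L :: problem where
  "PK_L = problem_of tree_leaf_name seq_set_name perfect_kernel"

end

theory Submission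
  imports Defs
begin

text \<open>
  Shifting all labels of a tree up by one and giving every node an extra terminal child labelled
  \<open>0\<close> makes the leaves exactly these new nodes, while infinite paths and perfect subtrees are
  merely shifted. Hence leaf information is never of help.

  A node \<open>\<sigma>\<close> belongs to the perfect kernel of \<open>T\<close> iff there is a sequence \<open>g\<close> of nodes of \<open>T\<close>,
  starting above \<open>\<sigma>\<close>, such that \<open>g (2 * i + 1)\<close> and \<open>g (2 * i + 2)\<close> are incompatible extensions of
  \<open>g i\<close>; the finite approximations to such a \<open>g\<close> form a tree computable from \<open>T\<close> and \<open>\<sigma>\<close>, which
  reduces \<open>PK\<close> to \<open>WF_hat\<close>. Conversely, attach \<open>T i\<close> above the node \<open>[i]\<close> of one tree, after
  pairing every label with an arbitrary number: every path then fans out to a perfect set of paths,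
  so \<open>[i]\<close> is in the perfect kernel iff \<open>T i\<close> is ill-founded.
\<close>

section \<open>Recursive functions in an oracle\<close>

lemma those_map_Some:
  "(\<And>x. x \<in> set l \<Longrightarrow> g x = Some (h x)) \<Longrightarrow> those (map g l) = Some (map h l)"
  by (induction l) auto

lemma map_case_nat_upt: "map (case_nat k e) [0..<Suc n] = k # map e [0..<n]"
  by (simp add: map_upt_Suc del: upt_Suc)

text \<open>
  The arguments are given by an environment \<open>e\<close>, of which only the first \<open>n\<close> entries matter. A bound
  variable becomes entry \<open>0\<close> and shifts the others, so that goals stay higher-order patterns and the
  rules in \<open>recursive_intros\<close> can be applied without instantiation.
\<close>

definition recursive_fun :: "nat \<Rightarrow> (baire \<Rightarrow> (nat \<Rightarrow> nat) \<Rightarrow> nat) \<Rightarrow> bool" where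
  "recursive_fun n f \<longleftrightarrow>
     (\<exists>F. partial_recursive n F \<and> (\<forall>p e. F p (map e [0..<n]) = Some (f p e)))"

definition recursive_rel :: "nat \<Rightarrow> (baire \<Rightarrow> (nat \<Rightarrow> nat) \<Rightarrow> bool) \<Rightarrow> bool" where
  "recursive_rel n P \<longleftrightarrow> recursive_fun n (\<lambda>p e. of_bool (P p e))"

definition recursive_list :: "nat \<Rightarrow> (baire \<Rightarrow> (nat \<Rightarrow> nat) \<Rightarrow> nat list) \<Rightarrow> bool" where
  "recursive_list n f \<longleftrightarrow> recursive_fun n (\<lambda>p e. list_encode (f p e))"

named_theorems recursive_intros

declare zero_less_Suc [recursive_intros] Suc_mono [recursive_intros]

text \<open>Substitution in environment form. A function in \<open>recursive_fun m\<close> depends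
  only on the first \<open>m\<close> entries, so the values of \<open>fs i\<close> for
  \<open>i \<ge> m\<close> may be arbitrary.\<close>

lemma recursive_fun_compose:
  assumes h: "recursive_fun m h" and fs: "\<And>i. i < m \<Longrightarrow> recursive_fun n (fs i)"
  shows "recursive_fun n (\<lambda>p e. h p (\<lambda>i. fs i p e))"
proof -
  obtain H where H: "partial_recursive m H" "\<And>p e. H p (map e [0..<m]) = Some (h p e)"
    using h unfolding recursive_fun_def by blast
  have "\<forall>i. \<exists>G. i < m \<longrightarrow> partial_recursive n G \<and>
      (\<forall>p e. G p (map e [0..<n]) = Some (fs i p e))"
    using fs unfolding recursive_fun_def by blast
  then obtain G where G: "\<And>i. i < m \<Longrightarrow> partial_recursive n (G i)"
      "\<And>i p e. i < m \<Longrightarrow> G i p (map e [0..<n]) = Some (fs i p e)"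
    by metis
  define Gs where "Gs = map G [0..<m]"
  have "partial_recursive n (\<lambda>p xs. Option.bind (those (map (\<lambda>G. G p xs) Gs)) (H p))"
    by (rule composition) (auto simp: Gs_def H G)
  moreover have "those (map (\<lambda>G. G p (map e [0..<n])) Gs) = Some (map (\<lambda>i. fs i p e) [0..<m])"
    for p e
    unfolding Gs_def map_map o_def by (rule those_map_Some) (simp add: G)
  ultimately show ?thesis
    unfolding recursive_fun_def by (intro exI conjI) (auto simp: H)
qed

lemma recursive_fun_var [recursive_intros]: "i < n \<Longrightarrow> recursive_fun n (\<lambda>p e. e i)"
  unfolding recursive_fun_def by (rule exI, rule conjI, rule projection) auto

text \<open>Reduces closure under \<open>h\<close> at arbitrary arguments to the case of variables,
  which can be copied under binders without weakening \<open>f\<close>.\<close>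

lemma recursive_fun_apply1:
  assumes "recursive_fun (Suc 0) (\<lambda>p e. h p (e 0))" "recursive_fun n f"
  shows "recursive_fun n (\<lambda>p e. h p (f p e))"
  using recursive_fun_compose[OF assms(1), of n "\<lambda>_. f"] assms(2) by simp

lemma recursive_fun_apply2:
  assumes "recursive_fun (Suc (Suc 0)) (\<lambda>p e. h p (e 0) (e (Suc 0)))" "recursive_fun n f" "recursive_fun n g"
  shows "recursive_fun n (\<lambda>p e. h p (f p e) (g p e))"
  using recursive_fun_compose[OF assms(1), of n "\<lambda>i. if i = 0 then f else g"] assms(2,3) by simp

lemma recursive_fun_Suc [recursive_intros]:
  "recursive_fun n f \<Longrightarrow> recursive_fun n (\<lambda>p e. Suc (f p e))"
  by (rule recursive_fun_apply1[where h="\<lambda>_. Suc"])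
     (auto simp: recursive_fun_def intro!: exI[of _ "\<lambda>p xs. Some (Suc (xs ! 0))"] successor[simplified])

lemma recursive_fun_oracle [recursive_intros]:
  "recursive_fun n f \<Longrightarrow> recursive_fun n (\<lambda>p e. p (f p e))"
  by (rule recursive_fun_apply1[where h="\<lambda>p. p"])
     (auto simp: recursive_fun_def intro!: exI[of _ "\<lambda>p xs. Some (p (xs ! 0))"] oracle_query[simplified])

lemma recursive_fun_const [recursive_intros]: "recursive_fun n (\<lambda>p e. c)"
proof (induction c)
  case 0
  show ?case
    unfolding recursive_fun_def by (intro exI[of _ "\<lambda>p xs. Some 0"]) (auto intro: zero)
qed (rule recursive_fun_Suc)

lemma recursive_fun_rec_nat [recursive_intros]:
  assumes a: "recursive_fun n a"
    and g: "recursive_fun (Suc (Suc n)) (\<lambda>p e. g p (\<lambda>i. e (Suc (Suc i))) (e 0) (e (Suc 0)))"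
    and b: "recursive_fun n b"
  shows "recursive_fun n (\<lambda>p e. rec_nat (a p e) (\<lambda>k r. g p e k r) (b p e))"
proof -
  obtain A where A: "partial_recursive n A" "\<And>p e. A p (map e [0..<n]) = Some (a p e)"
    using a unfolding recursive_fun_def by blast
  obtain G where G: "partial_recursive (Suc (Suc n)) G"
      "\<And>p e. G p (map e [0..<Suc (Suc n)]) =
         Some (g p (\<lambda>i. e (Suc (Suc i))) (e 0) (e (Suc 0)))"
    using g unfolding recursive_fun_def by blast
  have G': "G p (k # r # map e [0..<n]) = Some (g p e k r)" for p k r e
    using G(2)[of p "case_nat k (case_nat r e)"] by (simp add: map_case_nat_upt del: upt_Suc)
  define R where "R = (\<lambda>p xs. rec_nat (A p (tl xs))
    (\<lambda>k r. Option.bind r (\<lambda>v. G p (k # v # tl xs))) (hd xs))"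
  have "partial_recursive (Suc n) R"
    unfolding R_def by (rule primitive_recursion[OF A(1) G(1)])
  moreover have "R p (m # map e [0..<n]) = Some (rec_nat (a p e) (g p e) m)" for p m e
    unfolding R_def by (induction m) (auto simp: A G')
  then have "R p (map e [0..<Suc n]) =
      Some (rec_nat (a p (\<lambda>i. e (Suc i))) (g p (\<lambda>i. e (Suc i))) (e 0))" for p e
    by (simp add: map_upt_Suc del: upt_Suc)
  ultimately have "recursive_fun (Suc n)
      (\<lambda>p e. rec_nat (a p (\<lambda>i. e (Suc i))) (g p (\<lambda>i. e (Suc i))) (e 0))"
    unfolding recursive_fun_def by blast
  \<comment> \<open>\<open>case_nat\<close> puts the recursion bound \<open>b\<close> into entry
    \<open>0\<close> and passes the original variables on as parameters.\<close>
  from recursive_fun_compose[OF this, of n "case_nat b (\<lambda>i p e. e i)"] b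
  show ?thesis
    by (auto simp: recursive_fun_var split: nat.split)
qed

text \<open>Since \<open>q\<close> is total and has a zero, every search succeeds, so the partial
  \<open>minimize\<close> returns the plain \<open>LEAST\<close>.\<close>

lemma recursive_fun_Least:
  assumes q: "recursive_fun (Suc n) (\<lambda>p e. q p (\<lambda>i. e (Suc i)) (e 0))"
    and ex: "\<And>p e. \<exists>k. q p e k = 0"
  shows "recursive_fun n (\<lambda>p e. LEAST k. q p e k = 0)"
proof -
  obtain Q where Q: "partial_recursive (Suc n) Q"
      "\<And>p e. Q p (map e [0..<Suc n]) = Some (q p (\<lambda>i. e (Suc i)) (e 0))"
    using q unfolding recursive_fun_def by blast
  have Q': "Q p (k # map e [0..<n]) = Some (q p e k)" for p k e
    using Q(2)[of p "case_nat k e"] by (simp add: map_case_nat_upt del: upt_Suc)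
  show ?thesis
    unfolding recursive_fun_def
    by (intro exI conjI, rule minimization[OF Q(1)]) (auto simp: minimize_def Q' ex)
qed

section \<open>Arithmetic, Boolean connectives and bounded quantifiers\<close>

lemma recursive_fun_pred [recursive_intros]:
  assumes "recursive_fun n f" shows "recursive_fun n (\<lambda>p e. f p e - 1)"
proof -
  have "m - 1 = rec_nat 0 (\<lambda>k r. k) m" for m :: nat by (cases m) auto
  then show ?thesis
    by (simp only:) (rule recursive_intros assms)+
qed

lemma recursive_fun_add [recursive_intros]:
  assumes "recursive_fun n f" "recursive_fun n g" shows "recursive_fun n (\<lambda>p e. f p e + g p e)"
proof -
  have "m + k = rec_nat m (\<lambda>k r. Suc r) k" for m k :: nat by (induction k) auto
  then show ?thesis
    by (simp only:) (rule recursive_intros assms)+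
qed

lemma recursive_fun_diff [recursive_intros]:
  assumes "recursive_fun n f" "recursive_fun n g" shows "recursive_fun n (\<lambda>p e. f p e - g p e)"
proof -
  have "m - k = rec_nat m (\<lambda>k r. r - 1) k" for m k :: nat by (induction k) auto
  then have *: "(\<lambda>p e. f p e - g p e) = (\<lambda>p e. rec_nat (f p e) (\<lambda>k r. r - 1) (g p e))"
    by blast
  show ?thesis
    unfolding * by (rule recursive_intros assms)+
qed

lemma recursive_fun_mult [recursive_intros]:
  assumes "recursive_fun n f" "recursive_fun n g" shows "recursive_fun n (\<lambda>p e. f p e * g p e)"
proof (rule recursive_fun_apply2[where h="\<lambda>_. (*)", OF _ assms])
  have "m * k = rec_nat 0 (\<lambda>k r. r + m) k" for m k :: nat by (induction k) auto
  then show "recursive_fun (Suc (Suc 0)) (\<lambda>p e. e 0 * e (Suc 0))"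
    by (simp only:) (rule recursive_intros)+
qed

lemma recursive_fun_of_bool [recursive_intros]:
  "recursive_rel n P \<Longrightarrow> recursive_fun n (\<lambda>p e. of_bool (P p e))"
  by (simp add: recursive_rel_def)

lemma recursive_fun_list_encode [recursive_intros]:
  "recursive_list n f \<Longrightarrow> recursive_fun n (\<lambda>p e. list_encode (f p e))"
  by (simp add: recursive_list_def)

lemma recursive_rel_not [recursive_intros]:
  assumes "recursive_rel n P" shows "recursive_rel n (\<lambda>p e. \<not> P p e)"
proof -
  have "of_bool (\<not> b) = 1 - (of_bool b :: nat)" for b by simp
  then show ?thesis
    unfolding recursive_rel_def by (simp only:) (rule recursive_intros assms)+
qed

lemma recursive_rel_conj [recursive_intros]:
  assumes "recursive_rel n P" "recursive_rel n Q"
  shows "recursive_rel n (\<lambda>p e. P p e \<and> Q p e)"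
  unfolding recursive_rel_def of_bool_conj by (rule recursive_intros assms)+

lemma recursive_rel_disj [recursive_intros]:
  assumes "recursive_rel n P" "recursive_rel n Q"
  shows "recursive_rel n (\<lambda>p e. P p e \<or> Q p e)"
proof -
  have *: "a \<or> b \<longleftrightarrow> \<not> (\<not> a \<and> \<not> b)" for a b by blast
  show ?thesis unfolding * by (rule recursive_intros assms)+
qed

lemma recursive_rel_imp [recursive_intros]:
  assumes "recursive_rel n P" "recursive_rel n Q"
  shows "recursive_rel n (\<lambda>p e. P p e \<longrightarrow> Q p e)"
  unfolding imp_conv_disj by (rule recursive_intros assms)+

lemma recursive_rel_le [recursive_intros]:
  assumes "recursive_fun n f" "recursive_fun n g"
  shows "recursive_rel n (\<lambda>p e. f p e \<le> g p e)"
proof -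
  have "of_bool (a \<le> b) = 1 - (a - b)" for a b :: nat by auto
  then show ?thesis
    unfolding recursive_rel_def by (simp only:) (rule recursive_intros assms)+
qed

lemma recursive_rel_less [recursive_intros]:
  assumes "recursive_fun n f" "recursive_fun n g"
  shows "recursive_rel n (\<lambda>p e. f p e < g p e)"
  unfolding not_le[symmetric] by (rule recursive_intros assms)+

lemma recursive_rel_eq [recursive_intros]:
  assumes "recursive_fun n f" "recursive_fun n g"
  shows "recursive_rel n (\<lambda>p e. f p e = g p e)"
  unfolding order.eq_iff by (rule recursive_intros assms)+

lemma recursive_rel_ball [recursive_intros]:
  assumes "recursive_fun n b" "recursive_rel (Suc n) (\<lambda>p e. Q p (\<lambda>i. e (Suc i)) (e 0))"
  shows "recursive_rel n (\<lambda>p e. \<forall>k<b p e. Q p e k)"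
proof -
  \<comment> \<open>The truth value is accumulated by primitive recursion, starting from the empty
    conjunction \<open>1\<close>.\<close>
  have *: "of_bool (\<forall>k<m. Q p e k) =
      rec_nat 1 (\<lambda>k r. of_bool (r \<noteq> 0 \<and> Q p e k)) m" for p e m
  proof (induction m)
    case (Suc m)
    show ?case by (simp add: Suc[symmetric] less_Suc_eq) blast
  qed simp
  \<comment> \<open>In the recursion step entry \<open>1\<close> holds the accumulated value; this
    renaming skips it, so that \<open>Q\<close> sees only \<open>k\<close> and the
    parameters.\<close>
  have fs: "recursive_fun (Suc (Suc n)) (\<lambda>p e. case i of 0 \<Rightarrow> e 0 | Suc j \<Rightarrow> e (Suc (Suc j)))"
    if "i < Suc n" for i
    using that by (cases i) (auto intro!: recursive_fun_var)
  have Q: "recursive_rel (Suc (Suc n)) (\<lambda>p e. Q p (\<lambda>i. e (Suc (Suc i))) (e 0))"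
    using recursive_fun_compose[where fs = "\<lambda>i p e. case i of 0 \<Rightarrow> e 0 | Suc j \<Rightarrow> e (Suc (Suc j))",
        OF assms(2)[unfolded recursive_rel_def] fs]
    by (simp add: recursive_rel_def)
  show ?thesis
    unfolding recursive_rel_def * by (rule recursive_intros assms Q)+
qed

lemma recursive_rel_bex [recursive_intros]:
  assumes "recursive_fun n b" "recursive_rel (Suc n) (\<lambda>p e. Q p (\<lambda>i. e (Suc i)) (e 0))"
  shows "recursive_rel n (\<lambda>p e. \<exists>k<b p e. Q p e k)"
proof -
  have "(\<exists>k<c. R k) \<longleftrightarrow> \<not> (\<forall>k<c. \<not> R k)" for c :: nat and R by blast
  then show ?thesis
    by (simp only:) (rule recursive_intros assms)+
qed

lemma recursive_fun_if [recursive_intros]: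
  assumes "recursive_rel n P" "recursive_fun n f" "recursive_fun n g"
  shows "recursive_fun n (\<lambda>p e. if P p e then f p e else g p e)"
proof -
  have "(if b then x else y) = of_bool b * x + of_bool (\<not> b) * y" for b and x y :: nat by simp
  then show ?thesis
    by (simp only:) (rule recursive_intros assms)+
qed

text \<open>The value is found by unbounded search, which always ends because \<open>f\<close> is
  total. This yields functions that are easier to verify than to compute, such as inverses of
  codings.\<close>

lemma recursive_fun_graph:
  assumes "recursive_rel (Suc n) (\<lambda>p e. e 0 = f p (\<lambda>i. e (Suc i)))"
  shows "recursive_fun n f"
proof -
  have "recursive_fun n (\<lambda>p e. LEAST k. (of_bool (k \<noteq> f p e) :: nat) = 0)"
    by (rule recursive_fun_Least) (auto intro!: recursive_intros assms)
  moreover have "(LEAST k. k = f p e) = f p e" for p e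
    by (rule Least_equality) auto
  ultimately show ?thesis by simp
qed

section \<open>Coding of pairs and lists\<close>

lemma recursive_fun_prod_encode [recursive_intros]:
  assumes "recursive_fun n f" "recursive_fun n g"
  shows "recursive_fun n (\<lambda>p e. prod_encode (f p e, g p e))"
proof -
  have *: "triangle k = rec_nat 0 (\<lambda>k r. r + Suc k) k" for k by (induction k) auto
  show ?thesis
    unfolding prod_encode_def prod.case *
    by (rule recursive_fun_apply2[where h="\<lambda>_ a b. rec_nat 0 (\<lambda>k r. r + Suc k) (a + b) + a", OF _ assms])
       (rule recursive_intros)+
qed

lemma recursive_fun_fst_prod_decode [recursive_intros]:
  assumes "recursive_fun n f" shows "recursive_fun n (\<lambda>p e. fst (prod_decode (f p e)))"
proof (rule recursive_fun_apply1[where h="\<lambda>_ m. fst (prod_decode m)", OF _ assms], rule recursive_fun_graph)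
  \<comment> \<open>The unknown component is bounded by the code itself, so a bounded search
    suffices.\<close>
  have "k = fst (prod_decode m) \<longleftrightarrow> (\<exists>j<Suc m. prod_encode (k, j) = m)" for k m
  proof -
    obtain a b where "m = prod_encode (a, b)"
      by (metis prod_decode_inverse surj_pair)
    then show ?thesis
      by (auto simp: prod_encode_eq less_Suc_eq_le le_prod_encode_2)
  qed
  then show "recursive_rel (Suc (Suc 0)) (\<lambda>p e. e 0 = fst (prod_decode (e (Suc 0))))"
    by (simp only:) (rule recursive_intros)+
qed

lemma recursive_fun_snd_prod_decode [recursive_intros]:
  assumes "recursive_fun n f" shows "recursive_fun n (\<lambda>p e. snd (prod_decode (f p e)))"
proof (rule recursive_fun_apply1[where h="\<lambda>_ m. snd (prod_decode m)", OF _ assms], rule recursive_fun_graph)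
  have "k = snd (prod_decode m) \<longleftrightarrow> (\<exists>j<Suc m. prod_encode (j, k) = m)" for k m
  proof -
    obtain a b where "m = prod_encode (a, b)"
      by (metis prod_decode_inverse surj_pair)
    then show ?thesis
      by (auto simp: prod_encode_eq less_Suc_eq_le le_prod_encode_1)
  qed
  then show "recursive_rel (Suc (Suc 0)) (\<lambda>p e. e 0 = snd (prod_decode (e (Suc 0))))"
    by (simp only:) (rule recursive_intros)+
qed

lemma recursive_list_decode [recursive_intros]:
  "recursive_fun n f \<Longrightarrow> recursive_list n (\<lambda>p e. list_decode (f p e))"
  by (simp add: recursive_list_def)

lemma recursive_list_graph:
  assumes "recursive_rel (Suc n) (\<lambda>p e. list_decode (e 0) = f p (\<lambda>i. e (Suc i)))"
  shows "recursive_list n f"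
  unfolding recursive_list_def
proof (rule recursive_fun_graph)
  have "k = list_encode l \<longleftrightarrow> list_decode k = l" for k l by auto
  then show "recursive_rel (Suc n) (\<lambda>p e. e 0 = list_encode (f p (\<lambda>i. e (Suc i))))"
    using assms by simp
qed

lemma recursive_list_apply:
  assumes "recursive_fun (Suc 0) (\<lambda>p e. h p (list_decode (e 0)))" "recursive_list n l"
  shows "recursive_fun n (\<lambda>p e. h p (l p e))"
  using recursive_fun_apply1[of "\<lambda>p c. h p (list_decode c)", OF assms(1)] assms(2)
  by (fastforce simp: recursive_list_def)

lemma recursive_list_const [recursive_intros]: "recursive_list n (\<lambda>p e. c)"
  by (simp add: recursive_list_def recursive_fun_const)

lemma recursive_list_Cons [recursive_intros]:
  "recursive_fun n f \<Longrightarrow> recursive_list n l \<Longrightarrow> recursive_list n (\<lambda>p e. f p e # l p e)"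
  by (auto simp: recursive_list_def intro!: recursive_intros)

lemma prod_decode_0: "prod_decode 0 = (0, 0)"
  using prod_encode_inverse[of "(0, 0)"] by (simp add: prod_encode_def)

lemma recursive_list_drop [recursive_intros]:
  assumes "recursive_fun n f" "recursive_list n l"
  shows "recursive_list n (\<lambda>p e. drop (f p e) (l p e))"
proof -
  \<comment> \<open>The code of a nonempty list is \<open>Suc\<close> of the pair of head and coded
    tail. The empty list has code \<open>0\<close>, and \<open>0 - 1 = 0\<close> decodes to
    \<open>(0, 0)\<close>, so the formula holds there as well.\<close>
  have tl: "list_encode (tl xs) = snd (prod_decode (list_encode xs - 1))" for xs
    by (cases xs) (auto simp: prod_decode_0)
  have *: "list_encode (drop k xs) =
      rec_nat (list_encode xs) (\<lambda>_ r. snd (prod_decode (r - 1))) k" for k xs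
    by (induction k) (simp_all add: drop_Suc drop_tl tl)
  show ?thesis
    unfolding recursive_list_def * by (rule recursive_intros assms)+
qed

lemma recursive_rel_Nil [recursive_intros]:
  assumes "recursive_list n l" shows "recursive_rel n (\<lambda>p e. l p e = [])"
proof -
  have *: "l = [] \<longleftrightarrow> list_encode l = 0" for l by (cases l) auto
  show ?thesis unfolding * by (rule recursive_intros assms)+
qed

lemma recursive_fun_length [recursive_intros]:
  assumes "recursive_list n l" shows "recursive_fun n (\<lambda>p e. length (l p e))"
proof -
  \<comment> \<open>The length is the least number of entries whose removal leaves the empty
    list.\<close>
  have *: "k = length l \<longleftrightarrow> drop k l = [] \<and> (\<forall>j<k. drop j l \<noteq> [])" for k and l :: "nat list"
    unfolding drop_eq_Nil by (metis le_neq_implies_less le_refl not_le)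
  show ?thesis
    by (rule recursive_list_apply[where h="\<lambda>_. length", OF _ assms], rule recursive_fun_graph,
        unfold *) (rule recursive_intros)+
qed

text \<open>Needed because the values of \<open>(!)\<close> beyond the end of a list are unspecified.\<close>

definition nth_or_0 :: "nat list \<Rightarrow> nat \<Rightarrow> nat" where
  "nth_or_0 l i = (if i < length l then l ! i else 0)"

lemma nth_or_0_eq [simp]: "i < length l \<Longrightarrow> nth_or_0 l i = l ! i"
  by (simp add: nth_or_0_def)

lemma recursive_fun_nth_or_0 [recursive_intros]:
  assumes "recursive_list n l" "recursive_fun n f"
  shows "recursive_fun n (\<lambda>p e. nth_or_0 (l p e) (f p e))"
proof -
  \<comment> \<open>For the empty list the code arithmetic yields \<open>0\<close>, in agreement
    with the default value of \<open>nth_or_0\<close>.\<close>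
  have hd: "fst (prod_decode (list_encode xs - 1)) = (if xs = [] then 0 else hd xs)" for xs
    by (cases xs) (auto simp: prod_decode_0)
  have *: "nth_or_0 l i = fst (prod_decode (list_encode (drop i l) - 1))" for l i
    unfolding hd by (auto simp: nth_or_0_def hd_drop_conv_nth)
  show ?thesis unfolding * by (rule recursive_intros assms)+
qed

lemma recursive_rel_list_eq [recursive_intros]:
  assumes "recursive_list n l" "recursive_list n l'"
  shows "recursive_rel n (\<lambda>p e. l p e = l' p e)"
proof -
  have *: "l = l' \<longleftrightarrow> list_encode l = list_encode l'" for l l'
    by (auto simp: list_encode_eq)
  show ?thesis unfolding * by (rule recursive_intros assms)+
qed

lemma recursive_list_take [recursive_intros]:
  assumes "recursive_fun n f" "recursive_list n l"
  shows "recursive_list n (\<lambda>p e. take (f p e) (l p e))"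
proof -
  have *: "c = take k l \<longleftrightarrow>
    length c = (if k \<le> length l then k else length l) \<and>
    (\<forall>i<length c. nth_or_0 c i = nth_or_0 l i)" for c k l
    by (auto simp: list_eq_iff_nth_eq)
  have "recursive_list (Suc (Suc 0)) (\<lambda>p e. take (e 0) (list_decode (e (Suc 0))))"
    by (rule recursive_list_graph, unfold *) (rule recursive_intros)+
  from recursive_fun_apply2[of "\<lambda>p k c. list_encode (take k (list_decode c))", 
      OF this[unfolded recursive_list_def] assms(1) assms(2)[unfolded recursive_list_def]]
  show ?thesis by (simp add: recursive_list_def)
qed

lemma recursive_list_map:
  assumes "recursive_fun (Suc 0) (\<lambda>p e. h (e 0))" "recursive_list n l"
  shows "recursive_list n (\<lambda>p e. map h (l p e))"
  unfolding recursive_list_def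
proof (rule recursive_list_apply[OF _ assms(2)])
  have h: "recursive_fun n f \<Longrightarrow> recursive_fun n (\<lambda>p e. h (f p e))" for n f
    by (rule recursive_fun_apply1[OF assms(1)])
  have *: "c = map h l \<longleftrightarrow>
    length c = length l \<and> (\<forall>i<length c. nth_or_0 c i = h (nth_or_0 l i))" for c l
    by (auto simp: list_eq_iff_nth_eq)
  have "recursive_list (Suc 0) (\<lambda>p e. map h (list_decode (e 0)))"
    by (rule recursive_list_graph, unfold *) (rule recursive_intros h)+
  then show "recursive_fun (Suc 0) (\<lambda>p e. list_encode (map h (list_decode (e 0))))"
    by (simp add: recursive_list_def)
qed

lemma recursive_rel_prefix [recursive_intros]:
  assumes "recursive_list n l" "recursive_list n l'"
  shows "recursive_rel n (\<lambda>p e. prefix (l p e) (l' p e))"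
proof -
  have *: "prefix l l' \<longleftrightarrow> l = take (length l) l'" for l l' :: "nat list"
    by (metis append_eq_conv_conj prefix_def take_is_prefix)
  show ?thesis unfolding * by (rule recursive_intros assms)+
qed

lemma recursive_fun_div2 [recursive_intros]:
  assumes "recursive_fun n f" shows "recursive_fun n (\<lambda>p e. f p e div 2)"
proof (rule recursive_fun_apply1[where h="\<lambda>_ m. m div 2", OF _ assms], rule recursive_fun_graph)
  have "k = m div 2 \<longleftrightarrow> m = 2 * k \<or> m = Suc (2 * k)" for k m :: nat by arith
  then show "recursive_rel (Suc (Suc 0)) (\<lambda>p e. e 0 = e (Suc 0) div 2)"
    by (simp only:) (rule recursive_intros)+
qed

lemma recursive_rel_even [recursive_intros]:
  assumes "recursive_fun n f" shows "recursive_rel n (\<lambda>p e. even (f p e))"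
proof -
  have *: "even m \<longleftrightarrow> m = 2 * (m div 2)" for m :: nat
    by (metis dvd_triv_left even_two_times_div_two)
  show ?thesis by (subst *) (rule recursive_intros assms)+
qed

lemma recursive_rel_parallel [recursive_intros]:
  assumes "recursive_list n l" "recursive_list n l'"
  shows "recursive_rel n (\<lambda>p e. l p e \<parallel> l' p e)"
  unfolding parallel_def by (rule recursive_intros assms)+

section \<open>Substitution for the oracle, composition of functionals, transitivity\<close>

lemma length_those: "those l = Some ys \<Longrightarrow> length ys = length l"
  by (induction l arbitrary: ys) (auto split: option.splits)

text \<open>Every oracle query in \<open>F\<close> is replaced by a call of \<open>G\<close>; all
  other schemes are kept. Agreement is claimed at lists of the proper length only, since values
  elsewhere carry no meaning.\<close>

lemma partial_recursive_oracle_subst: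
  assumes "partial_recursive n F" and G: "partial_recursive 1 G"
  shows "\<exists>F'. partial_recursive n F' \<and>
    (\<forall>p q xs. (\<forall>k. G p [k] = Some (q k)) \<longrightarrow> length xs = n \<longrightarrow> F' p xs = F q xs)"
  using assms(1)
proof (induction rule: partial_recursive.induct)
  case (zero n)
  show ?case using partial_recursive.zero by blast
next
  case successor
  show ?case using partial_recursive.successor by blast
next
  case (projection i n)
  then show ?case using partial_recursive.projection by blast
next
  case oracle_query
  have "\<forall>p q xs. (\<forall>k. G p [k] = Some (q k)) \<longrightarrow> length xs = 1 \<longrightarrow> G p xs = Some (q (xs ! 0))"
    by (auto simp: length_Suc_conv)
  with G show ?case by blast
next
  case (composition Gs F n)
  obtain F' where F': "partial_recursive (length Gs) F'"
    "\<And>p q xs. \<forall>k. G p [k] = Some (q k) \<Longrightarrow> length xs = length Gs \<Longrightarrow> F' p xs = F q xs"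
    using composition.IH(1) by blast
  obtain H where H: "\<And>g. g \<in> set Gs \<Longrightarrow> partial_recursive n (H g)"
    "\<And>g p q xs. g \<in> set Gs \<Longrightarrow> \<forall>k. G p [k] = Some (q k) \<Longrightarrow> length xs = n \<Longrightarrow> H g p xs = g q xs"
    using composition.IH(2) by metis
  have "partial_recursive n
      (\<lambda>p xs. Option.bind (those (map (\<lambda>g. g p xs) (map H Gs))) (F' p))"
    by (rule partial_recursive.composition) (auto simp: F' H)
  moreover have "Option.bind (those (map (\<lambda>g. g p xs) (map H Gs))) (F' p) =
      Option.bind (those (map (\<lambda>g. g q xs) Gs)) (F q)"
    if "\<forall>k. G p [k] = Some (q k)" "length xs = n" for p q xs
  proof -
    have eq: "map (\<lambda>g. g p xs) (map H Gs) = map (\<lambda>g. g q xs) Gs"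
      using H(2) that by auto
    then show ?thesis
      \<comment> \<open>The induction hypothesis for \<open>F\<close> applies because the list of
        inner values has the length of \<open>Gs\<close>.\<close>
      unfolding eq using F'(2)[OF that(1)]
      by (cases "those (map (\<lambda>g. g q xs) Gs)") (auto dest: length_those)
  qed
  ultimately show ?case by blast
next
  case (primitive_recursion n F K)
  obtain F' where F': "partial_recursive n F'"
    "\<And>p q xs. \<forall>k. G p [k] = Some (q k) \<Longrightarrow> length xs = n \<Longrightarrow> F' p xs = F q xs"
    using primitive_recursion.IH(1) by blast
  obtain K' where K': "partial_recursive (Suc (Suc n)) K'"
    "\<And>p q xs. \<forall>k. G p [k] = Some (q k) \<Longrightarrow> length xs = Suc (Suc n) \<Longrightarrow> K' p xs = K q xs"
    using primitive_recursion.IH(2) by blast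
  have "rec_nat (F' p (tl xs)) (\<lambda>k r. Option.bind r (\<lambda>v. K' p (k # v # tl xs))) m =
      rec_nat (F q (tl xs)) (\<lambda>k r. Option.bind r (\<lambda>v. K q (k # v # tl xs))) m"
    if "\<forall>k. G p [k] = Some (q k)" "length xs = Suc n" for p q xs m
    using that by (induction m) (auto simp: F'(2)[OF that(1)] K'(2)[OF that(1)])
  with partial_recursive.primitive_recursion[OF F'(1) K'(1)] show ?case by blast
next
  case (minimization n F)
  obtain F' where F': "partial_recursive (Suc n) F'"
    "\<And>p q xs. \<forall>k. G p [k] = Some (q k) \<Longrightarrow> length xs = Suc n \<Longrightarrow> F' p xs = F q xs"
    using minimization.IH by blast
  have "minimize (\<lambda>k. F' p (k # xs)) = minimize (\<lambda>k. F q (k # xs))"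
    if "\<forall>k. G p [k] = Some (q k)" "length xs = n" for p q xs
    using that by (simp add: F'(2)[OF that(1)])
  with partial_recursive.minimization[OF F'(1)] show ?case by blast
qed

lemma computable_functional_compose:
  assumes "computable_functional \<Phi>" "computable_functional \<Psi>"
  shows "computable_functional (\<lambda>p. Option.bind (\<Phi> p) \<Psi>)"
proof -
  obtain F where F: "partial_recursive 1 F" "\<And>p q n. \<Phi> p = Some q \<Longrightarrow> F p [n] = Some (q n)"
    using assms(1) unfolding computable_functional_def by blast
  obtain G where G: "partial_recursive 1 G" "\<And>p q n. \<Psi> p = Some q \<Longrightarrow> G p [n] = Some (q n)"
    using assms(2) unfolding computable_functional_def by blast
  obtain H where "partial_recursive 1 H"
    "\<And>p q xs. \<forall>k. F p [k] = Some (q k) \<Longrightarrow> length xs = 1 \<Longrightarrow> H p xs = G q xs"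
    using partial_recursive_oracle_subst[OF G(1) F(1)] by blast
  then show ?thesis
    unfolding computable_functional_def bind_eq_Some_conv
    using F(2) G(2) by (intro exI[of _ H]) force
qed

text \<open>Forward functionals compose in the order of the reductions, backward ones in the reverse
  order.\<close>

lemma sW_le_trans: assumes "f \<le>\<^sub>s\<^sub>W g" "g \<le>\<^sub>s\<^sub>W h" shows "f \<le>\<^sub>s\<^sub>W h"
proof -
  obtain \<Phi>1 \<Psi>1 where 1: "computable_functional \<Phi>1" "computable_functional \<Psi>1"
    "\<And>x. x \<in> instances f \<Longrightarrow> \<exists>x'. \<Phi>1 x = Some x' \<and> x' \<in> instances g \<and>
       (\<forall>y\<in>solutions g x'. \<exists>z. \<Psi>1 y = Some z \<and> z \<in> solutions f x)"
    using assms(1) unfolding sW_le_def by blast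
  obtain \<Phi>2 \<Psi>2 where 2: "computable_functional \<Phi>2" "computable_functional \<Psi>2"
    "\<And>x. x \<in> instances g \<Longrightarrow> \<exists>x'. \<Phi>2 x = Some x' \<and> x' \<in> instances h \<and>
       (\<forall>y\<in>solutions h x'. \<exists>z. \<Psi>2 y = Some z \<and> z \<in> solutions g x)"
    using assms(2) unfolding sW_le_def by blast
  show ?thesis
    unfolding sW_le_def
  proof (rule exI[of _ "\<lambda>p. Option.bind (\<Phi>1 p) \<Phi>2"], rule exI[of _ "\<lambda>p. Option.bind (\<Psi>2 p) \<Psi>1"],
      intro conjI ballI)
    show "computable_functional (\<lambda>p. Option.bind (\<Phi>1 p) \<Phi>2)"
         "computable_functional (\<lambda>p. Option.bind (\<Psi>2 p) \<Psi>1)"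
      by (intro computable_functional_compose 1 2)+
    fix x assume "x \<in> instances f"
    from 1(3)[OF this] 2(3)
    show "\<exists>x'. Option.bind (\<Phi>1 x) \<Phi>2 = Some x' \<and> x' \<in> instances h \<and>
        (\<forall>y\<in>solutions h x'. \<exists>z. Option.bind (\<Psi>2 y) \<Psi>1 = Some z \<and> z \<in> solutions f x)"
      by (metis bind.bind_lunit)
  qed
qed

lemma computable_functional_Some:
  assumes "recursive_fun (Suc 0) (\<lambda>p e. \<phi> p (e 0))"
  shows "computable_functional (\<lambda>p. Some (\<phi> p))"
proof -
  obtain F where F: "partial_recursive (Suc 0) F"
      "\<And>p e. F p (map e [0..<Suc 0]) = Some (\<phi> p (e 0))"
    using assms unfolding recursive_fun_def by blast
  have "F p [n] = Some (\<phi> p n)" for p n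
    using F(2)[of p "\<lambda>_. n"] by simp
  then show ?thesis
    unfolding computable_functional_def using F(1) by auto
qed

section \<open>Reductions between problems given by names\<close>

text \<open>A solution on \<open>\<phi> p\<close> answers some point named by
  \<open>\<phi> p\<close>. Uniqueness of named points identifies it with \<open>h x\<close>, so the
  backward map may rely on a name of \<open>F' (h x)\<close>.\<close>

lemma problem_of_sW_le:
  assumes "recursive_fun (Suc 0) (\<lambda>p e. \<phi> p (e 0))" "recursive_fun (Suc 0) (\<lambda>p e. \<psi> p (e 0))"
    and "\<And>p x. \<delta>\<^sub>X p x \<Longrightarrow> \<delta>\<^sub>X' (\<phi> p) (h x)"
    and "\<And>p x y. \<delta>\<^sub>X' p x \<Longrightarrow> \<delta>\<^sub>X' p y \<Longrightarrow> x = y"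
    and "\<And>p x q. \<delta>\<^sub>X p x \<Longrightarrow> \<delta>\<^sub>Y' q (F' (h x)) \<Longrightarrow> \<delta>\<^sub>Y (\<psi> q) (F x)"
  shows "problem_of \<delta>\<^sub>X \<delta>\<^sub>Y F \<le>\<^sub>s\<^sub>W problem_of \<delta>\<^sub>X' \<delta>\<^sub>Y' F'"
  unfolding sW_le_def problem_of_def
  using computable_functional_Some[OF assms(1)] computable_functional_Some[OF assms(2)] assms(3-5)
  by simp (metis (no_types, lifting))

lemma seq_set_name_unique: "seq_set_name p A \<Longrightarrow> seq_set_name p B \<Longrightarrow> A = B"
  unfolding seq_set_name_def by (metis set_eqI zero_neq_one)

lemma tree_name_unique: "tree_name p S \<Longrightarrow> tree_name p T \<Longrightarrow> S = T"
  by (auto simp: tree_name_def dest: seq_set_name_unique)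

lemma tree_leaf_name_unique: "tree_leaf_name p S \<Longrightarrow> tree_leaf_name p T \<Longrightarrow> S = T"
  by (auto simp: tree_leaf_name_def dest: tree_name_unique)

lemma family_name_unique:
  assumes "\<And>p x y. \<delta> p x \<Longrightarrow> \<delta> p y \<Longrightarrow> x = y" "family_name \<delta> p X" "family_name \<delta> p Y"
  shows "X = Y"
  using assms unfolding family_name_def by blast

text \<open>List coding is a bijection, so every position of a name is the code of some
  sequence.\<close>

lemma seq_set_name_iff: "seq_set_name p A \<longleftrightarrow> (\<forall>m. p m = of_bool (list_decode m \<in> A))"
  unfolding seq_set_name_def by (metis list_decode_inverse list_encode_inverse of_bool_def)

lemma tree_nameD: "tree_name p T \<Longrightarrow> p (list_encode \<sigma>) = of_bool (\<sigma> \<in> T)"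
  by (simp add: tree_name_def seq_set_name_def)

lemma is_treeD: "is_tree T \<Longrightarrow> \<tau> \<in> T \<Longrightarrow> prefix \<sigma> \<tau> \<Longrightarrow> \<sigma> \<in> T"
  by (auto simp: is_tree_def)

text \<open>The parallelization of \<open>\<phi>\<close>: \<open>m\<close> codes the index of a
  component and a position in the transformed name of that component.\<close>

definition family_lift :: "(baire \<Rightarrow> baire) \<Rightarrow> baire \<Rightarrow> baire" where
  "family_lift \<phi> p m = \<phi> (\<lambda>n. p (prod_encode (fst (prod_decode m), n))) (snd (prod_decode m))"

lemma family_name_lift:
  assumes "family_name \<delta> p X" "\<And>p x. \<delta> p x \<Longrightarrow> \<delta>' (\<phi> p) (h x)"
  shows "family_name \<delta>' (family_lift \<phi> p) (\<lambda>i. h (X i))"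
  using assms by (simp add: family_name_def family_lift_def)

section \<open>Forgetting the leaves\<close>

lemma tree_leaf_name_tree_name: "tree_leaf_name p T \<Longrightarrow> tree_name (\<lambda>n. p (2 * n)) T"
  by (simp add: tree_leaf_name_def)

lemma problem_of_leaf_sW_le:
  "problem_of tree_leaf_name \<delta> F \<le>\<^sub>s\<^sub>W problem_of tree_name \<delta> F"
  by (rule problem_of_sW_le[where \<phi> = "\<lambda>p n. p (2 * n)" and \<psi> = "\<lambda>p. p" and h = "\<lambda>T. T"])
     (auto intro!: recursive_intros tree_leaf_name_tree_name dest: tree_name_unique)

lemma problem_of_family_leaf_sW_le:
  "problem_of (family_name tree_leaf_name) \<delta> F \<le>\<^sub>s\<^sub>W problem_of (family_name tree_name) \<delta> F"
proof (rule problem_of_sW_le[where \<phi> = "family_lift (\<lambda>p n. p (2 * n))" and \<psi> = "\<lambda>p. p" and h = "\<lambda>T. T"])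
  show "recursive_fun (Suc 0) (\<lambda>p e. family_lift (\<lambda>p n. p (2 * n)) p (e 0))"
    unfolding family_lift_def by (rule recursive_intros)+
  show "X = Y" if "family_name tree_name p X" "family_name tree_name p Y" for p X Y
    using tree_name_unique that by (rule family_name_unique)
  show "family_name tree_name (family_lift (\<lambda>p n. p (2 * n)) p) X"
    if "family_name tree_leaf_name p X" for p X
    using that tree_leaf_name_tree_name by (rule family_name_lift)
  show "recursive_fun (Suc 0) (\<lambda>p e. p (e 0))"
    by (rule recursive_intros)+
qed

section \<open>Making the leaves decidable\<close>

definition leafy_tree :: "nat list set \<Rightarrow> nat list set" where
  "leafy_tree T = map Suc ` T \<union> (\<lambda>\<sigma>. map Suc \<sigma> @ [0]) ` T"

text \<open>Shifting is injective, and \<open>0\<close> never occurs in a shifted node, so no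
  shifted node is one of the added nodes.\<close>

lemma map_Suc_mem_leafy_tree [simp]: "map Suc \<sigma> \<in> leafy_tree T \<longleftrightarrow> \<sigma> \<in> T"
proof -
  have "map Suc \<sigma> \<noteq> map Suc \<tau> @ [0]" for \<tau>
    by (metis in_set_conv_decomp imageE list.set_map nat.distinct(1))
  then show ?thesis
    by (auto simp: leafy_tree_def inj_map_eq_map)
qed

lemma is_tree_leafy_tree:
  assumes "is_tree T" shows "is_tree (leafy_tree T)"
proof -
  have *: "\<sigma> \<in> map Suc ` T" if "prefix \<sigma> (map Suc \<tau>)" "\<tau> \<in> T" for \<sigma> \<tau>
  proof -
    have "\<sigma> = map Suc (take (length \<sigma>) \<tau>)"
      using that(1) by (metis append_eq_conv_conj prefix_def take_map)
    then show ?thesis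
      using is_treeD[OF assms that(2) take_is_prefix] by blast
  qed
  show ?thesis
    unfolding is_tree_def leafy_tree_def by (auto simp: * dest: *)
qed

text \<open>A shifted node has its added child above it. Above an added node there is nothing:
  \<open>0\<close> does not occur in shifted nodes, and in added nodes it occurs only at the
  end.\<close>

lemma leaf_leafy_tree: "leaf (leafy_tree T) = (\<lambda>\<sigma>. map Suc \<sigma> @ [0]) ` T"
proof -
  have "map Suc \<sigma> \<notin> leaf (leafy_tree T)" if "\<sigma> \<in> T" for \<sigma>
    using that unfolding leaf_def leafy_tree_def by (auto simp: strict_prefix_def intro!: bexI[of _ "map Suc \<sigma> @ [0]"])
  moreover have "\<not> strict_prefix (map Suc \<sigma> @ [0]) \<tau>" if "\<tau> \<in> leafy_tree T" for \<sigma> \<tau>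
  proof
    assume less: "strict_prefix (map Suc \<sigma> @ [0]) \<tau>"
    from that consider \<rho> where "\<tau> = map Suc \<rho>" | \<rho> where "\<tau> = map Suc \<rho> @ [0]"
      unfolding leafy_tree_def by blast
    then have "\<exists>\<rho>. prefix (map Suc \<sigma> @ [0]) (map Suc \<rho>)"
      using less by cases (auto simp: strict_prefix_def)
    then obtain \<rho> where "prefix (map Suc \<sigma> @ [0]) (map Suc \<rho>)" ..
    then have "0 \<in> set (map Suc \<rho>)"
      using set_mono_prefix by fastforce
    then show False by auto
  qed
  then have "map Suc \<sigma> @ [0] \<in> leaf (leafy_tree T)" if "\<sigma> \<in> T" for \<sigma>
    using that unfolding leaf_def by (auto simp: leafy_tree_def)
  moreover have "leaf (leafy_tree T) \<subseteq> map Suc ` T \<union> (\<lambda>\<sigma>. map Suc \<sigma> @ [0]) ` T"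
    by (auto simp: leaf_def leafy_tree_def)
  ultimately show ?thesis
    by blast
qed

lemma well_founded_leafy_tree: "well_founded_tree (leafy_tree T) \<longleftrightarrow> well_founded_tree T"
proof -
  have "\<exists>g. \<forall>n. map g [0..<n] \<in> T" if f: "\<And>n. map f [0..<n] \<in> leafy_tree T" for f
  proof (intro exI allI)
    fix n
    have nz: "f i \<noteq> 0" for i
    proof
      assume "f i = 0"
      \<comment> \<open>Position \<open>i\<close> is not the last one in the initial segment of
        length \<open>i + 2\<close>, whereas nodes of the tree can have \<open>0\<close> only in
        last position.\<close>
      then have "0 \<in> set (butlast (map f [0..<Suc (Suc i)]))"
        by (simp add: butlast_append)
      moreover have "0 \<notin> set (butlast \<tau>)" if "\<tau> \<in> leafy_tree T" for \<tau>
        using that unfolding leafy_tree_def by (auto simp: map_butlast[symmetric])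
      ultimately show False
        using f by blast
    qed
    have "map f [0..<n] = map Suc (map (\<lambda>i. f i - 1) [0..<n])"
      using nz by simp
    then show "map (\<lambda>i. f i - 1) [0..<n] \<in> T"
      using f[of n] by (metis map_Suc_mem_leafy_tree)
  qed
  moreover have "\<exists>g. \<forall>n. map g [0..<n] \<in> leafy_tree T" if "\<And>n. map f [0..<n] \<in> T" for f
  proof (intro exI allI)
    fix n
    have "map (\<lambda>i. Suc (f i)) [0..<n] = map Suc (map f [0..<n])"
      by simp
    then show "map (\<lambda>i. Suc (f i)) [0..<n] \<in> leafy_tree T"
      using that by (metis map_Suc_mem_leafy_tree)
  qed
  ultimately show ?thesis
    unfolding well_founded_tree_def by blast
qed

text \<open>Both interleaved names are computed at once: even \<open>m\<close> asks whether the node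
  coded by \<open>m div 2\<close> is in the tree, odd \<open>m\<close> whether it is a leaf. An
  added node (\<open>ends\<close>) answers both positively, a shifted one (\<open>inner\<close>)
  only the first.\<close>

definition leafy_name :: "baire \<Rightarrow> baire" where
  "leafy_name p m = (let \<sigma> = list_decode (m div 2); k = length \<sigma> - 1;
      ends = (\<sigma> \<noteq> [] \<and> nth_or_0 \<sigma> k = 0 \<and> (\<forall>i<k. nth_or_0 \<sigma> i \<noteq> 0) \<and>
        p (list_encode (map (\<lambda>i. i - 1) (take k \<sigma>))) = 1);
      inner = ((\<forall>i<length \<sigma>. nth_or_0 \<sigma> i \<noteq> 0) \<and> p (list_encode (map (\<lambda>i. i - 1) \<sigma>)) = 1)
    in of_bool (ends \<or> even m \<and> inner))"

text \<open>Truncated subtraction undoes \<open>Suc\<close> only at positive labels, hence the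
  conjunct excluding \<open>0\<close>. In this form membership can be tested from a name of
  \<open>T\<close>.\<close>

lemma mem_map_Suc_image_iff:
  "\<sigma> \<in> map Suc ` T \<longleftrightarrow> (\<forall>i<length \<sigma>. nth_or_0 \<sigma> i \<noteq> 0) \<and> map (\<lambda>i. i - 1) \<sigma> \<in> T"
proof safe
  assume nz: "\<forall>i<length \<sigma>. nth_or_0 \<sigma> i \<noteq> 0" and "map (\<lambda>i. i - 1) \<sigma> \<in> T"
  moreover have "\<sigma> = map Suc (map (\<lambda>i. i - 1) \<sigma>)"
    using nz by (simp add: list_eq_iff_nth_eq)
  ultimately show "\<sigma> \<in> map Suc ` T"
    by (metis imageI)
qed (auto simp: o_def)

lemma mem_map_Suc_snoc_image_iff:
  "\<sigma> \<in> (\<lambda>\<tau>. map Suc \<tau> @ [0]) ` T \<longleftrightarrow> \<sigma> \<noteq> [] \<and> nth_or_0 \<sigma> (length \<sigma> - 1) = 0 \<and>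
     (\<forall>i<length \<sigma> - 1. nth_or_0 \<sigma> i \<noteq> 0) \<and> map (\<lambda>i. i - 1) (take (length \<sigma> - 1) \<sigma>) \<in> T"
proof (cases \<sigma> rule: rev_cases)
  case (snoc \<tau> a)
  \<comment> \<open>Splitting off the last label reduces the claim to the test for shifted
    nodes.\<close>
  have "\<sigma> \<in> (\<lambda>\<tau>. map Suc \<tau> @ [0]) ` T \<longleftrightarrow> a = 0 \<and> \<tau> \<in> map Suc ` T"
    unfolding snoc by auto
  then show ?thesis
    unfolding mem_map_Suc_image_iff by (auto simp: snoc nth_append nth_or_0_def)
qed auto

lemma tree_leaf_name_leafy:
  assumes "tree_name p T" shows "tree_leaf_name (leafy_name p) (leafy_tree T)"
proof -
  have p: "p (list_encode \<sigma>) = 1 \<longleftrightarrow> \<sigma> \<in> T" for \<sigma>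
    using tree_nameD[OF assms] by simp
  have "leafy_name p (2 * m) = of_bool (list_decode m \<in> leafy_tree T)" for m
    unfolding leafy_name_def Let_def p leafy_tree_def Un_iff mem_map_Suc_image_iff
      mem_map_Suc_snoc_image_iff by auto
  moreover have "leafy_name p (2 * m + 1) = of_bool (list_decode m \<in> leaf (leafy_tree T))" for m
    unfolding leafy_name_def Let_def p leaf_leafy_tree mem_map_Suc_snoc_image_iff by auto
  ultimately show ?thesis
    using assms unfolding tree_leaf_name_def tree_name_def seq_set_name_iff
    by (simp add: is_tree_leafy_tree)
qed

lemma recursive_fun_leafy_name: "recursive_fun (Suc 0) (\<lambda>p e. leafy_name p (e 0))"
  unfolding leafy_name_def Let_def by (rule recursive_intros recursive_list_map)+

text \<open>Here the oracle of \<open>leafy_name\<close> is a component of \<open>p\<close>.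
  Unfolding turns its queries into queries to \<open>p\<close>, so the closure rules apply
  directly.\<close>

lemma recursive_fun_family_leafy_name:
  "recursive_fun (Suc 0) (\<lambda>p e. family_lift leafy_name p (e 0))"
  unfolding leafy_name_def family_lift_def Let_def by (rule recursive_intros recursive_list_map)+

lemma WF_sW_le_WF_L: "WF \<le>\<^sub>s\<^sub>W WF_L"
  unfolding WF_def WF_L_def
proof (rule problem_of_sW_le[where h = leafy_tree and \<phi> = leafy_name and \<psi> = "\<lambda>p. p"])
  show "recursive_fun (Suc 0) (\<lambda>p e. leafy_name p (e 0))"
    by (rule recursive_fun_leafy_name)
  show "tree_leaf_name (leafy_name p) (leafy_tree T)" if "tree_name p T" for p T
    using that by (rule tree_leaf_name_leafy)
  show "S = T" if "tree_leaf_name p S" "tree_leaf_name p T" for p S T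
    using that by (rule tree_leaf_name_unique)
  show "recursive_fun (Suc 0) (\<lambda>p e. p (e 0))"
    by (rule recursive_intros)+
  show "nat_name q (wf_value T)" if "nat_name q (wf_value (leafy_tree T))" for q T
    using that by (simp add: wf_value_def well_founded_leafy_tree)
qed

lemma WF_hat_sW_le_WF_hat_L: "WF_hat \<le>\<^sub>s\<^sub>W WF_hat_L"
  unfolding WF_hat_def WF_hat_L_def
proof (rule problem_of_sW_le[where h = "\<lambda>X i. leafy_tree (X i)"
      and \<phi> = "family_lift leafy_name" and \<psi> = "\<lambda>p. p"])
  show "recursive_fun (Suc 0) (\<lambda>p e. family_lift leafy_name p (e 0))"
    by (rule recursive_fun_family_leafy_name)
  show "recursive_fun (Suc 0) (\<lambda>p e. p (e 0))"
    by (rule recursive_intros)+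
  show "family_name tree_leaf_name (family_lift leafy_name p) (\<lambda>i. leafy_tree (X i))"
    if "family_name tree_name p X" for p X
    using that tree_leaf_name_leafy by (rule family_name_lift)
  show "X = Y" if "family_name tree_leaf_name p X" "family_name tree_leaf_name p Y" for p X Y
    using tree_leaf_name_unique that by (rule family_name_unique)
  show "nat_set_name q (wf_indices X)" if "nat_set_name q (wf_indices (\<lambda>i. leafy_tree (X i)))" for q X
    using that by (simp add: wf_indices_def well_founded_leafy_tree)
qed

section \<open>Perfect kernels of leafy trees\<close>

lemma perfect_subtreeD:
  assumes "perfect_subtree S T" "\<sigma> \<in> S"
  obtains \<tau> \<rho> where "\<tau> \<in> S" "\<rho> \<in> S" "prefix \<sigma> \<tau>" "prefix \<sigma> \<rho>" "\<tau> \<parallel> \<rho>"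
  using assms unfolding perfect_subtree_def by blast

lemma perfect_kernel_iff: "\<sigma> \<in> perfect_kernel T \<longleftrightarrow> (\<exists>S. perfect_subtree S T \<and> \<sigma> \<in> S)"
  by (auto simp: perfect_kernel_def)

text \<open>Of two incompatible extensions of \<open>\<sigma>\<close> neither can equal
  \<open>\<sigma>\<close>, as it would then be a prefix of the other.\<close>

lemma perfect_subtree_not_leaf:
  assumes "perfect_subtree S T" "\<sigma> \<in> S"
  shows "\<exists>\<tau>\<in>S. strict_prefix \<sigma> \<tau>"
proof -
  obtain \<tau> \<rho> where "\<tau> \<in> S" "\<rho> \<in> S" "prefix \<sigma> \<tau>" "prefix \<sigma> \<rho>" "\<tau> \<parallel> \<rho>"
    using perfect_subtreeD[OF assms] .
  then show ?thesis
    by (metis parallel_def strict_prefix_def)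
qed

lemma prefix_map_Suc_iff: "prefix (map Suc \<sigma>) (map Suc \<tau>) \<longleftrightarrow> prefix \<sigma> \<tau>"
proof
  assume "prefix (map Suc \<sigma>) (map Suc \<tau>)"
  then have "prefix (map (\<lambda>i. i - 1) (map Suc \<sigma>)) (map (\<lambda>i. i - 1) (map Suc \<tau>))"
    by (rule map_mono_prefix)
  then show "prefix \<sigma> \<tau>"
    by (simp add: o_def)
qed (rule map_mono_prefix)

text \<open>Perfect subtrees are carried over by image and preimage under
  \<open>map Suc\<close>.\<close>

lemma map_Suc_mem_perfect_kernel_leafy_tree:
  "map Suc \<sigma> \<in> perfect_kernel (leafy_tree T) \<longleftrightarrow> \<sigma> \<in> perfect_kernel T"
proof
  assume "\<sigma> \<in> perfect_kernel T"
  then obtain S where S: "perfect_subtree S T" "\<sigma> \<in> S"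
    by (auto simp: perfect_kernel_iff)
  have "perfect_subtree (map Suc ` S) (leafy_tree T)"
    unfolding perfect_subtree_def
  proof (intro conjI ballI)
    show "is_tree (map Suc ` S)"
      unfolding is_tree_def
    proof safe
      fix \<sigma> \<tau> assume "\<tau> \<in> S" and "prefix \<sigma> (map Suc \<tau>)"
      then have "\<sigma> = map Suc (take (length \<sigma>) \<tau>)"
        by (metis append_eq_conv_conj prefix_def take_map)
      moreover have "take (length \<sigma>) \<tau> \<in> S"
        using S(1) \<open>\<tau> \<in> S\<close> take_is_prefix unfolding perfect_subtree_def is_tree_def by blast
      ultimately show "\<sigma> \<in> map Suc ` S" by blast
    qed
    show "map Suc ` S \<subseteq> leafy_tree T"
      using S(1) by (auto simp: perfect_subtree_def)
    fix \<rho> assume "\<rho> \<in> map Suc ` S"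
    then obtain \<sigma> where "\<sigma> \<in> S" "\<rho> = map Suc \<sigma>" by blast
    moreover obtain \<tau>1 \<tau>2 where "\<tau>1 \<in> S" "\<tau>2 \<in> S" "prefix \<sigma> \<tau>1" "prefix \<sigma> \<tau>2" "\<tau>1 \<parallel> \<tau>2"
      using perfect_subtreeD[OF S(1) \<open>\<sigma> \<in> S\<close>] .
    ultimately show "\<exists>\<tau>\<in>map Suc ` S. \<exists>\<rho>'\<in>map Suc ` S. prefix \<rho> \<tau> \<and> prefix \<rho> \<rho>' \<and> \<tau> \<parallel> \<rho>'"
      by (intro bexI[of _ "map Suc \<tau>1"] bexI[of _ "map Suc \<tau>2"])
         (auto simp: prefix_map_Suc_iff parallel_def)
  qed
  with S(2) show "map Suc \<sigma> \<in> perfect_kernel (leafy_tree T)"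
    by (auto simp: perfect_kernel_iff)
next
  assume "map Suc \<sigma> \<in> perfect_kernel (leafy_tree T)"
  then obtain S where S: "perfect_subtree S (leafy_tree T)" "map Suc \<sigma> \<in> S"
    by (auto simp: perfect_kernel_iff)
  \<comment> \<open>A perfect subtree contains no leaf of the ambient tree, hence none of the added
    nodes.\<close>
  have inner: "\<exists>\<tau>\<in>T. \<rho> = map Suc \<tau>" if "\<rho> \<in> S" for \<rho>
  proof -
    have "\<rho> \<notin> leaf (leafy_tree T)"
      using perfect_subtree_not_leaf[OF S(1) that] S(1)
      unfolding leaf_def perfect_subtree_def by blast
    moreover have "\<rho> \<in> leafy_tree T"
      using S(1) that unfolding perfect_subtree_def by blast
    ultimately show ?thesis
      unfolding leaf_leafy_tree by (auto simp: leafy_tree_def)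
  qed
  have "perfect_subtree {\<sigma>. map Suc \<sigma> \<in> S} T"
    unfolding perfect_subtree_def
  proof (intro conjI ballI)
    show "is_tree {\<sigma>. map Suc \<sigma> \<in> S}"
      using S(1) map_mono_prefix unfolding perfect_subtree_def is_tree_def by blast
    show "{\<sigma>. map Suc \<sigma> \<in> S} \<subseteq> T"
      using inner inj_map_eq_map[OF inj_Suc] by fastforce
    fix \<sigma> assume "\<sigma> \<in> {\<sigma>. map Suc \<sigma> \<in> S}"
    then have "map Suc \<sigma> \<in> S" by simp
    then obtain \<tau> \<rho> where "\<tau> \<in> S" "\<rho> \<in> S" "prefix (map Suc \<sigma>) \<tau>" "prefix (map Suc \<sigma>) \<rho>" "\<tau> \<parallel> \<rho>"
      using perfect_subtreeD[OF S(1)] by metis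
    moreover from this obtain \<tau>' \<rho>' where "\<tau> = map Suc \<tau>'" "\<rho> = map Suc \<rho>'"
      using inner by blast
    ultimately show "\<exists>\<tau>\<in>{\<sigma>. map Suc \<sigma> \<in> S}. \<exists>\<rho>\<in>{\<sigma>. map Suc \<sigma> \<in> S}.
        prefix \<sigma> \<tau> \<and> prefix \<sigma> \<rho> \<and> \<tau> \<parallel> \<rho>"
      by (intro bexI[of _ \<tau>'] bexI[of _ \<rho>']) (auto simp: prefix_map_Suc_iff parallel_def)
  qed
  with S(2) show "\<sigma> \<in> perfect_kernel T"
    by (auto simp: perfect_kernel_iff)
qed

lemma PK_sW_le_PK_L: "PK \<le>\<^sub>s\<^sub>W PK_L"
  unfolding PK_def PK_L_def
proof (rule problem_of_sW_le[where h = leafy_tree and \<phi> = leafy_name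
      and \<psi> = "\<lambda>p n. p (list_encode (map Suc (list_decode n)))"])
  show "recursive_fun (Suc 0) (\<lambda>p e. leafy_name p (e 0))"
    by (rule recursive_fun_leafy_name)
  show "tree_leaf_name (leafy_name p) (leafy_tree T)" if "tree_name p T" for p T
    using that by (rule tree_leaf_name_leafy)
  show "S = T" if "tree_leaf_name p S" "tree_leaf_name p T" for p S T
    using that by (rule tree_leaf_name_unique)
  let ?\<psi> = "\<lambda>p n. p (list_encode (map Suc (list_decode n)))"
  show "recursive_fun (Suc 0) (\<lambda>p e. ?\<psi> p (e 0))"
    by (rule recursive_intros recursive_list_map)+
  show "seq_set_name (?\<psi> q) (perfect_kernel T)"
    if "seq_set_name q (perfect_kernel (leafy_tree T))" for q T
    using that unfolding seq_set_name_def by (simp add: map_Suc_mem_perfect_kernel_leafy_tree)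
qed

section \<open>Perfect kernels and well-foundedness\<close>

text \<open>Heap indexing of the full binary tree: the children of \<open>i\<close> are
  \<open>2 * i + 1\<close> and \<open>2 * i + 2\<close>. Hence node \<open>Suc n\<close> has parent
  \<open>n div 2\<close> and is a left child iff \<open>n\<close> is even.\<close>

fun branching_scheme :: "('a \<Rightarrow> 'a) \<Rightarrow> ('a \<Rightarrow> 'a) \<Rightarrow> 'a \<Rightarrow> nat \<Rightarrow> 'a" where
  "branching_scheme l r a 0 = a"
| "branching_scheme l r a (Suc n) =
     (if even n then l else r) (branching_scheme l r a (n div 2))"

text \<open>From a perfect subtree, choose two incompatible extensions of every element and iterate
  from \<open>\<sigma>\<close>. Conversely, the initial segments of the values of \<open>g\<close>
  form a perfect subtree.\<close>

lemma perfect_kernel_iff_scheme: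
  assumes "is_tree T"
  shows "\<sigma> \<in> perfect_kernel T \<longleftrightarrow> (\<exists>g :: nat \<Rightarrow> nat list. prefix \<sigma> (g 0) \<and> (\<forall>i. g i \<in> T \<and>
    prefix (g i) (g (2 * i + 1)) \<and> prefix (g i) (g (2 * i + 2)) \<and> g (2 * i + 1) \<parallel> g (2 * i + 2)))"
    (is "_ \<longleftrightarrow> (\<exists>g. ?scheme g)")
proof
  assume "\<sigma> \<in> perfect_kernel T"
  then obtain S where S: "perfect_subtree S T" "\<sigma> \<in> S"
    by (auto simp: perfect_kernel_iff)
  then have "\<forall>\<sigma>\<in>S. \<exists>\<tau> \<rho>. \<tau> \<in> S \<and> \<rho> \<in> S \<and> prefix \<sigma> \<tau> \<and> prefix \<sigma> \<rho> \<and> \<tau> \<parallel> \<rho>"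
    by (meson perfect_subtreeD)
  then obtain l r where lr: "\<And>\<sigma>. \<sigma> \<in> S \<Longrightarrow> l \<sigma> \<in> S \<and> r \<sigma> \<in> S \<and> prefix \<sigma> (l \<sigma>) \<and> prefix \<sigma> (r \<sigma>) \<and> l \<sigma> \<parallel> r \<sigma>"
    by metis
  have "branching_scheme l r \<sigma> i \<in> S" for i
  proof (induction i rule: less_induct)
    case (less i)
    then show ?case
      by (cases i) (auto simp: S lr)
  qed
  then have "?scheme (branching_scheme l r \<sigma>)"
    using lr S(1) by (auto simp: perfect_subtree_def)
  then show "\<exists>g. ?scheme g" by blast
next
  assume "\<exists>g. ?scheme g"
  then obtain g where g: "?scheme g" ..
  let ?S = "{\<rho>. \<exists>i. prefix \<rho> (g i)}"
  have "perfect_subtree ?S T"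
    unfolding perfect_subtree_def
  proof (intro conjI ballI)
    show "is_tree ?S"
      unfolding is_tree_def using prefix_order.trans by blast
    show "?S \<subseteq> T"
      using g is_treeD[OF assms] by blast
    fix \<rho> assume "\<rho> \<in> ?S"
    then obtain i where "prefix \<rho> (g i)" by blast
    then show "\<exists>\<tau>\<in>?S. \<exists>\<rho>'\<in>?S. prefix \<rho> \<tau> \<and> prefix \<rho> \<rho>' \<and> \<tau> \<parallel> \<rho>'"
      using g by (intro bexI[of _ "g (2 * i + 1)"] bexI[of _ "g (2 * i + 2)"])
        (auto intro: prefix_order.trans)
  qed
  moreover have "\<sigma> \<in> ?S"
    using g by blast
  ultimately show "\<sigma> \<in> perfect_kernel T"
    by (auto simp: perfect_kernel_iff)
qed

text \<open>Local condition at \<open>i\<close> for an approximation with \<open>n\<close> entries;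
  branching is demanded only once both children are present. \<open>P\<close> stands for membership
  in the tree, so that one formula serves for the set and for the oracle test.\<close>

definition scheme_at ::
    "(nat list \<Rightarrow> bool) \<Rightarrow> nat list \<Rightarrow> nat \<Rightarrow> (nat \<Rightarrow> nat list) \<Rightarrow> nat \<Rightarrow> bool" where
  "scheme_at P \<sigma> n g i \<longleftrightarrow> P (g i) \<and> (i = 0 \<longrightarrow> prefix \<sigma> (g i)) \<and>
     (2 * i + 2 < n \<longrightarrow>
       prefix (g i) (g (2 * i + 1)) \<and> prefix (g i) (g (2 * i + 2)) \<and> g (2 * i + 1) \<parallel> g (2 * i + 2))"

definition scheme_tree :: "nat list \<Rightarrow> nat list set \<Rightarrow> nat list set" where
  "scheme_tree \<sigma> T = {\<tau>. \<forall>i<length \<tau>.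
     scheme_at (\<lambda>\<rho>. \<rho> \<in> T) \<sigma> (length \<tau>) (\<lambda>i. list_decode (nth_or_0 \<tau> i)) i}"

text \<open>The condition at \<open>i\<close> consults only entries below the length, and a shorter
  sequence has fewer conditions to meet.\<close>

lemma is_tree_scheme_tree: "is_tree (scheme_tree \<sigma> T)"
proof -
  have nth: "nth_or_0 \<rho> i = nth_or_0 \<tau> i" if "prefix \<rho> \<tau>" "i < length \<rho>" for \<rho> \<tau> i
    using that by (auto simp: prefix_def nth_append nth_or_0_def)
  have "\<rho> \<in> scheme_tree \<sigma> T" if "\<tau> \<in> scheme_tree \<sigma> T" "prefix \<rho> \<tau>" for \<tau> \<rho>
    unfolding scheme_tree_def mem_Collect_eq
  proof (intro allI impI)
    fix i assume i: "i < length \<rho>"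
    then have "scheme_at (\<lambda>\<rho>. \<rho> \<in> T) \<sigma> (length \<tau>) (\<lambda>i. list_decode (nth_or_0 \<tau> i)) i"
      using that(1) prefix_length_le[OF that(2)] by (simp add: scheme_tree_def)
    then show "scheme_at (\<lambda>\<rho>. \<rho> \<in> T) \<sigma> (length \<rho>) (\<lambda>i. list_decode (nth_or_0 \<rho> i)) i"
      using i prefix_length_le[OF that(2)] unfolding scheme_at_def
      by (auto simp: nth[OF that(2)] simp del: nth_or_0_eq)
  qed
  then show ?thesis
    unfolding is_tree_def by blast
qed

text \<open>The infinite paths are the sequences of codes of complete schemes above
  \<open>\<sigma>\<close>.\<close>

lemma not_well_founded_scheme_tree:
  assumes "is_tree T"
  shows "\<not> well_founded_tree (scheme_tree \<sigma> T) \<longleftrightarrow> \<sigma> \<in> perfect_kernel T"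
proof
  assume "\<not> well_founded_tree (scheme_tree \<sigma> T)"
  then obtain f where f: "\<And>n. map f [0..<n] \<in> scheme_tree \<sigma> T"
    unfolding well_founded_tree_def by blast
  let ?g = "\<lambda>i. list_decode (f i)"
  have "?g i \<in> T \<and> (i = 0 \<longrightarrow> prefix \<sigma> (?g i)) \<and> prefix (?g i) (?g (2 * i + 1)) \<and>
      prefix (?g i) (?g (2 * i + 2)) \<and> ?g (2 * i + 1) \<parallel> ?g (2 * i + 2)" for i
    \<comment> \<open>Length \<open>2 * i + 3\<close> is the least at which the branching condition
      at \<open>i\<close> becomes active.\<close>
    using f[of "2 * i + 3"] unfolding scheme_tree_def scheme_at_def
    by (auto simp del: upt_Suc dest!: spec[of _ i])
  then show "\<sigma> \<in> perfect_kernel T"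
    unfolding perfect_kernel_iff_scheme[OF assms] by (intro exI[of _ ?g]) auto
next
  assume "\<sigma> \<in> perfect_kernel T"
  then obtain g :: "nat \<Rightarrow> nat list" where g: "prefix \<sigma> (g 0)"
    "\<And>i. g i \<in> T" "\<And>i. prefix (g i) (g (2 * i + 1))" "\<And>i. prefix (g i) (g (2 * i + 2))"
    "\<And>i. g (2 * i + 1) \<parallel> g (2 * i + 2)"
    unfolding perfect_kernel_iff_scheme[OF assms] by blast
  then have "map (\<lambda>i. list_encode (g i)) [0..<n] \<in> scheme_tree \<sigma> T" for n
    unfolding scheme_tree_def scheme_at_def by auto
  then show "\<not> well_founded_tree (scheme_tree \<sigma> T)"
    unfolding well_founded_tree_def by (auto intro!: exI[of _ "\<lambda>i. list_encode (g i)"])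
qed

definition scheme_name :: "baire \<Rightarrow> baire" where
  "scheme_name p m = (let \<tau> = list_decode (snd (prod_decode m)) in
     of_bool (\<forall>i<length \<tau>. scheme_at (\<lambda>\<rho>. p (list_encode \<rho>) = 1) (list_decode (fst (prod_decode m)))
       (length \<tau>) (\<lambda>i. list_decode (nth_or_0 \<tau> i)) i))"

lemma family_name_scheme_name:
  assumes "tree_name p T"
  shows "family_name tree_name (scheme_name p) (\<lambda>i. scheme_tree (list_decode i) T)"
proof -
  have "p (list_encode \<sigma>) = 1 \<longleftrightarrow> \<sigma> \<in> T" for \<sigma>
    using tree_nameD[OF assms] by simp
  then have "scheme_name p (prod_encode (i, m)) = of_bool (list_decode m \<in> scheme_tree (list_decode i) T)"
    for i m by (simp add: scheme_name_def scheme_tree_def Let_def)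
  then show ?thesis
    by (simp add: family_name_def tree_name_def seq_set_name_iff is_tree_scheme_tree)
qed

lemma PK_sW_le_WF_hat: "PK \<le>\<^sub>s\<^sub>W WF_hat"
  unfolding PK_def WF_hat_def
proof (rule problem_of_sW_le[where h = "\<lambda>T i. scheme_tree (list_decode i) T"
      and \<phi> = scheme_name and \<psi> = "\<lambda>p n. 1 - p n"])
  show "family_name tree_name (scheme_name p) (\<lambda>i. scheme_tree (list_decode i) T)"
    if "tree_name p T" for p T
    using that by (rule family_name_scheme_name)
  \<comment> \<open>The component of index \<open>list_encode \<sigma>\<close> is well-founded iff
    \<open>\<sigma>\<close> lies outside the kernel, so flipping every bit gives a name of the
    kernel.\<close>
  let ?\<psi> = "\<lambda>p n. 1 - p n :: nat"
  show "recursive_fun (Suc 0) (\<lambda>p e. scheme_name p (e 0))"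
    unfolding scheme_name_def scheme_at_def Let_def by (rule recursive_intros)+
  show "recursive_fun (Suc 0) (\<lambda>p e. ?\<psi> p (e 0))"
    by (rule recursive_intros)+
  show "X = Y" if "family_name tree_name p X" "family_name tree_name p Y" for p X Y
    using tree_name_unique that by (rule family_name_unique)
  show "seq_set_name (?\<psi> q) (perfect_kernel T)"
    if "tree_name p T" "nat_set_name q (wf_indices (\<lambda>i. scheme_tree (list_decode i) T))" for p T q
    using that not_well_founded_scheme_tree[of T]
    by (auto simp: seq_set_name_def nat_set_name_def wf_indices_def tree_name_def)
qed

section \<open>Coding well-foundedness into the perfect kernel of a fan tree\<close>

definition fan_tree :: "(nat \<Rightarrow> nat list set) \<Rightarrow> nat list set" where
  "fan_tree T = insert [] {i # \<mu> | i \<mu>. map (\<lambda>m. fst (prod_decode m)) \<mu> \<in> T i}"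

lemma is_tree_fan_tree:
  assumes "\<And>i. is_tree (T i)" shows "is_tree (fan_tree T)"
  unfolding is_tree_def fan_tree_def
  by (auto simp: prefix_Cons) (meson assms is_treeD map_mono_prefix)

text \<open>Strict extensions inside \<open>S\<close> are iterated from \<open>\<sigma>\<close>;
  their lengths grow without bound, and their limit is the path.\<close>

lemma perfect_subtree_path:
  assumes S: "perfect_subtree S T" "\<sigma> \<in> S"
  shows "\<exists>f. (\<forall>n. map f [0..<n] \<in> S) \<and> map f [0..<length \<sigma>] = \<sigma>"
proof -
  obtain nxt where nxt: "\<And>\<tau>. \<tau> \<in> S \<Longrightarrow> nxt \<tau> \<in> S \<and> strict_prefix \<tau> (nxt \<tau>)"
    using perfect_subtree_not_leaf[OF S(1)] by metis
  define s where "s n = (nxt ^^ n) \<sigma>" for n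
  have S: "s n \<in> S" for n
    by (induction n) (auto simp: s_def assms(2) nxt)
  have step: "strict_prefix (s n) (s (Suc n))" for n
    using nxt[OF S[of n]] by (simp add: s_def)
  have len: "n \<le> length (s n)" for n
  proof (induction n)
    case (Suc n)
    with prefix_length_less[OF step[of n]] show ?case by simp
  qed simp
  have mono: "prefix (s m) (s n)" if "m \<le> n" for m n
    using that step
    by (induction rule: dec_induct) (auto intro: prefix_order.trans prefix_order.less_imp_le)
  have nth: "s m ! k = s n ! k" if "k < length (s m)" "m \<le> n" for m n k
    using mono[OF that(2)] that(1) by (auto simp: prefix_def nth_append)
  \<comment> \<open>\<open>s (Suc k)\<close> has length at least \<open>k + 1\<close>, so its entry
    at \<open>k\<close> exists, and later stages keep it.\<close>
  define f where "f k = s (Suc k) ! k" for k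
  have "map f [0..<n] = take n (s n)" for n
    using len[of n] nth len[of "Suc _"] by (intro nth_equalityI) (auto simp: f_def Suc_le_eq)
  then have "map f [0..<n] \<in> S" for n
    using assms(1) S take_is_prefix unfolding perfect_subtree_def is_tree_def by metis
  moreover have "map f [0..<length \<sigma>] = \<sigma>"
    using nth[of _ 0] by (intro nth_equalityI) (auto simp: f_def s_def[of 0])
  ultimately show ?thesis by blast
qed

lemma singleton_mem_perfect_kernel_fan_tree:
  "[i] \<in> perfect_kernel (fan_tree T) \<longleftrightarrow> \<not> well_founded_tree (T i)"
proof
  assume "[i] \<in> perfect_kernel (fan_tree T)"
  then obtain S where S: "perfect_subtree S (fan_tree T)" "[i] \<in> S"
    by (auto simp: perfect_kernel_iff)
  obtain f where "(\<forall>n. map f [0..<n] \<in> S) \<and> map f [0..<length [i]] = [i]"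
    using perfect_subtree_path[OF S] ..
  then have f: "map f [0..<n] \<in> S" "map f [0..<length [i]] = [i]" for n
    by simp_all
  have "map (\<lambda>k. fst (prod_decode (f (Suc k)))) [0..<n] \<in> T i" for n
  proof -
    have "map f [0..<Suc n] = i # map (\<lambda>k. f (Suc k)) [0..<n]"
      using f(2) by (simp add: map_upt_Suc del: upt_Suc)
    moreover have "map f [0..<Suc n] \<in> fan_tree T"
      using f(1)[of "Suc n"] S(1) unfolding perfect_subtree_def by blast
    ultimately show ?thesis
      unfolding fan_tree_def by (simp add: o_def del: upt_Suc)
  qed
  then show "\<not> well_founded_tree (T i)"
    unfolding well_founded_tree_def by (auto intro!: exI[of _ "\<lambda>k. fst (prod_decode (f (Suc k)))"])
next
  assume "\<not> well_founded_tree (T i)"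
  then obtain f where f: "\<And>n. map f [0..<n] \<in> T i"
    unfolding well_founded_tree_def by blast
  let ?d = "\<lambda>m. fst (prod_decode m)"
  \<comment> \<open>The labels above \<open>[i]\<close> must project to the chosen path
    \<open>f\<close>; their second components are free.\<close>
  let ?S = "insert [] {i # \<mu> | \<mu>. map ?d \<mu> = map f [0..<length \<mu>]}"
  have "perfect_subtree ?S (fan_tree T)"
    unfolding perfect_subtree_def
  proof (intro conjI ballI)
    have "map ?d \<mu> = map f [0..<length \<mu>]" if "prefix \<mu> \<nu>" "map ?d \<nu> = map f [0..<length \<nu>]" for \<mu> \<nu>
    proof -
      have "map ?d \<mu> = take (length \<mu>) (map ?d \<nu>)"
        using that(1) by (auto simp: prefix_def)
      then show ?thesis
        using prefix_length_le[OF that(1)] that(2) by (simp add: take_map min_def)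
    qed
    then show "is_tree ?S"
      unfolding is_tree_def by (auto simp: prefix_Cons)
    show "?S \<subseteq> fan_tree T"
      using f by (auto simp: fan_tree_def)
    fix \<sigma> assume "\<sigma> \<in> ?S"
    \<comment> \<open>The branching below is constructed above \<open>[i]\<close>, so the root is
      first extended to \<open>[i]\<close>.\<close>
    then obtain \<mu> where \<mu>: "map ?d \<mu> = map f [0..<length \<mu>]" "prefix \<sigma> (i # \<mu>)"
    proof (cases "\<sigma> = []")
      case True
      then show ?thesis using that[of "[]"] by simp
    next
      case False
      with \<open>\<sigma> \<in> ?S\<close> show ?thesis using that by auto
    qed
    \<comment> \<open>The new label projects to the next value of \<open>f\<close>; its free
      component \<open>b\<close> makes the extensions for \<open>0\<close> and \<open>1\<close>
      incompatible.\<close>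
    let ?\<tau> = "\<lambda>b. i # \<mu> @ [prod_encode (f (length \<mu>), b)]"
    have "?\<tau> b \<in> ?S" "prefix \<sigma> (?\<tau> b)" for b
      using \<mu> by (auto simp: prefix_Cons intro: prefix_prefix)
    moreover have "?\<tau> 0 \<parallel> ?\<tau> 1"
      by (simp add: parallel_def prod_encode_eq)
    ultimately show "\<exists>\<tau>\<in>?S. \<exists>\<rho>\<in>?S. prefix \<sigma> \<tau> \<and> prefix \<sigma> \<rho> \<and> \<tau> \<parallel> \<rho>"
      by blast
  qed
  then show "[i] \<in> perfect_kernel (fan_tree T)"
    by (auto simp: perfect_kernel_iff)
qed

text \<open>The list \<open>i # \<mu>\<close> has code
  \<open>Suc (prod_encode (i, list_encode \<mu>))\<close> and the root has code \<open>0\<close>;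
  hence \<open>m - 1\<close> and the case \<open>m = 0\<close>.\<close>

definition fan_name :: "baire \<Rightarrow> baire" where
  "fan_name p m = (let i = fst (prod_decode (m - 1)); \<mu> = list_decode (snd (prod_decode (m - 1))) in
     of_bool (m = 0 \<or> p (prod_encode (i, list_encode (map (\<lambda>k. fst (prod_decode k)) \<mu>))) = 1))"

lemma tree_name_fan_name:
  assumes "family_name tree_name p T" shows "tree_name (fan_name p) (fan_tree T)"
proof -
  have T: "tree_name (\<lambda>n. p (prod_encode (i, n))) (T i)" for i
    using assms by (simp add: family_name_def)
  have "p (prod_encode (i, list_encode \<sigma>)) = 1 \<longleftrightarrow> \<sigma> \<in> T i" for i \<sigma>
    using tree_nameD[OF T] by simp
  then have "fan_name p m = of_bool (list_decode m \<in> fan_tree T)" for m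
    by (cases m) (auto simp: fan_name_def fan_tree_def Let_def split: prod.split)
  moreover have "is_tree (fan_tree T)"
    using T by (intro is_tree_fan_tree) (simp add: tree_name_def)
  ultimately show ?thesis
    unfolding tree_name_def seq_set_name_iff by blast
qed

lemma WF_hat_sW_le_PK: "WF_hat \<le>\<^sub>s\<^sub>W PK"
  unfolding PK_def WF_hat_def
proof (rule problem_of_sW_le[where h = fan_tree and \<phi> = fan_name
      and \<psi> = "\<lambda>p n. 1 - p (list_encode [n])"])
  \<comment> \<open>Of the kernel only the nodes \<open>[n]\<close> are consulted; the bit is
    flipped because \<open>[n]\<close> belongs to it iff tree number \<open>n\<close> is
    ill-founded.\<close>
  let ?\<psi> = "\<lambda>p n. 1 - p (list_encode [n]) :: nat"
  show "tree_name (fan_name p) (fan_tree T)" if "family_name tree_name p T" for p T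
    using that by (rule tree_name_fan_name)
  show "recursive_fun (Suc 0) (\<lambda>p e. fan_name p (e 0))"
    unfolding fan_name_def Let_def by (rule recursive_intros recursive_list_map)+
  show "recursive_fun (Suc 0) (\<lambda>p e. ?\<psi> p (e 0))"
    by (rule recursive_intros)+
  show "S = T" if "tree_name p S" "tree_name p T" for p S T
    using that by (rule tree_name_unique)
  show "nat_set_name (?\<psi> q) (wf_indices T)" if "seq_set_name q (perfect_kernel (fan_tree T))" for q T
    using that singleton_mem_perfect_kernel_fan_tree[of _ T]
    unfolding seq_set_name_def nat_set_name_def wf_indices_def by (simp del: list_encode.simps)
qed

theorem theorem11:
  shows "WF \<equiv>\<^sub>s\<^sub>W WF_L \<and>
    (\<forall>f \<in> {WF_hat, WF_hat_L, PK, PK_L}. \<forall>g \<in> {WF_hat, WF_hat_L, PK, PK_L}. f \<equiv>\<^sub>s\<^sub>W g)"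
proof -
  have WF: "WF_L \<le>\<^sub>s\<^sub>W WF"
    unfolding WF_def WF_L_def by (rule problem_of_leaf_sW_le)
  have PK: "PK_L \<le>\<^sub>s\<^sub>W PK"
    unfolding PK_def PK_L_def by (rule problem_of_leaf_sW_le)
  have WF_hat: "WF_hat_L \<le>\<^sub>s\<^sub>W WF_hat"
    unfolding WF_hat_def WF_hat_L_def by (rule problem_of_family_leaf_sW_le)
  \<comment> \<open>Each of the four problems is compared with \<open>WF_hat\<close> in both
    directions; the pairwise equivalences then follow by transitivity.\<close>
  have from_WF_hat: "WF_hat \<le>\<^sub>s\<^sub>W g" if "g \<in> {WF_hat, WF_hat_L, PK, PK_L}" for g
    using that WF_hat_sW_le_WF_hat_L WF_hat_sW_le_PK PK_sW_le_PK_L PK_sW_le_WF_hat sW_le_trans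
    by blast
  have to_WF_hat: "f \<le>\<^sub>s\<^sub>W WF_hat" if "f \<in> {WF_hat, WF_hat_L, PK, PK_L}" for f
    using that WF_hat PK WF_hat_sW_le_PK PK_sW_le_WF_hat sW_le_trans by blast
  show ?thesis
    using WF_sW_le_WF_L WF from_WF_hat to_WF_hat sW_le_trans unfolding sW_equiv_def by meson
qed

end
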